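(* Let $\mathcal{A}$ be a finite alphabet of modalities and $\mathcal{F}$ a class of $\mathcal{A}$-frames. Let $\mathcal{F}^{\mathrm{r}}=\{F^{\mathrm{r}}\mid F\in\mathcal{F}\}$, where for $F=(X,(R_\Diamond)_{\Diamond\in\mathcal{A}})$, $F^{\mathrm{r}}=(X,(R_\Diamond\cup\{(a,a)\mid a\in X\})_{\Diamond\in\mathcal{A}})$. Then the logic of $\mathcal{F}$ is locally tabular if and only if the logic of $\mathcal{F}^{\mathrm{r}}$ is locally tabular.
   Context: Modal formulas over $\mathcal{A}$ are built from variables $p_0,p_1,\ldots$ using $\bot,\to$, $\Diamond\in\mathcal{A}$; the logic of a class of frames is the set of formulas valid in all its frames. A logic $L$ is locally tabular if for every $k<\omega$ there are only finitely many formulas in $p_0,\ldots,p_{k-1}$ pairwise non-equivalent modulo $L$. *)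

theory Defs
  imports Main
begin

datatype (modalities: 'm) fm =
    Var nat
  | Bot
  | Imp "'m fm" "'m fm"
  | Dia 'm "'m fm"

primrec vars :: "'m fm \<Rightarrow> nat set" where
  "vars (Var i) = {i}"
| "vars Bot = {}"
| "vars (Imp \<phi> \<psi>) = vars \<phi> \<union> vars \<psi>"
| "vars (Dia m \<phi>) = vars \<phi>"

definition Iff :: "'m fm \<Rightarrow> 'm fm \<Rightarrow> 'm fm" where
  "Iff \<phi> \<psi> = Imp (Imp (Imp \<phi> \<psi>) (Imp (Imp \<psi> \<phi>) Bot)) Bot"

definition formulas :: "'m set \<Rightarrow> 'm fm set" where
  "formulas A = {\<phi>. modalities \<phi> \<subseteq> A}"

text \<open>The alphabet is a set \<open>A\<close> rather than the whole type, so that it may be empty. Relations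
  \<open>rel F m\<close> with \<open>m \<notin> A\<close> are junk: no formula over \<open>A\<close> looks at them.\<close>

record ('w, 'm) frame =
  worlds :: "'w set"
  rel :: "'m \<Rightarrow> ('w \<times> 'w) set"

definition is_frame :: "'m set \<Rightarrow> ('w, 'm) frame \<Rightarrow> bool" where
  "is_frame A F \<longleftrightarrow> worlds F \<noteq> {} \<and> (\<forall>m\<in>A. rel F m \<subseteq> worlds F \<times> worlds F)"

primrec sat :: "('w, 'm) frame \<Rightarrow> (nat \<Rightarrow> 'w set) \<Rightarrow> 'w \<Rightarrow> 'm fm \<Rightarrow> bool" where
  "sat F V x (Var i) \<longleftrightarrow> x \<in> V i"
| "sat F V x Bot \<longleftrightarrow> False"
| "sat F V x (Imp \<phi> \<psi>) \<longleftrightarrow> (sat F V x \<phi> \<longrightarrow> sat F V x \<psi>)"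
| "sat F V x (Dia m \<phi>) \<longleftrightarrow> (\<exists>y\<in>worlds F. (x, y) \<in> rel F m \<and> sat F V y \<phi>)"

definition valid :: "('w, 'm) frame \<Rightarrow> 'm fm \<Rightarrow> bool" where
  "valid F \<phi> \<longleftrightarrow> (\<forall>V. (\<forall>i. V i \<subseteq> worlds F) \<longrightarrow> (\<forall>x\<in>worlds F. sat F V x \<phi>))"

definition logic :: "'m set \<Rightarrow> ('w, 'm) frame set \<Rightarrow> 'm fm set" where
  "logic A \<F> = {\<phi> \<in> formulas A. \<forall>F\<in>\<F>. valid F \<phi>}"

definition locally_tabular :: "'m set \<Rightarrow> 'm fm set \<Rightarrow> bool" where
  "locally_tabular A L \<longleftrightarrow>
     (\<forall>k. \<forall>S \<subseteq> {\<phi> \<in> formulas A. vars \<phi> \<subseteq> {..<k}}.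
        pairwise (\<lambda>\<phi> \<psi>. Iff \<phi> \<psi> \<notin> L) S \<longrightarrow> finite S)"

definition refl_frame :: "('w, 'm) frame \<Rightarrow> ('w, 'm) frame" where
  "refl_frame F = \<lparr>worlds = worlds F, rel = (\<lambda>m. rel F m \<union> Id_on (worlds F))\<rparr>"

end

theory Submission
  imports Defs
begin

text \<open>Going from \<open>\<F>\<close> to its reflexive closure is the translation of \<open>\<Diamond>\<phi>\<close> to \<open>\<phi> \<or> \<Diamond>\<phi>\<close>.

  Conversely, evaluate \<open>\<Diamond>\<phi>\<close> at \<open>x\<close> over the reflexive closure. A successor of \<open>x\<close> there that
  differs from \<open>x\<close> on some formula \<open>\<theta>\<close> is a genuine successor, so \<open>\<Diamond>\<phi>\<close> is implied by
  \<open>\<theta> \<and> \<Diamond>(\<phi> \<and> \<not>\<theta>)\<close> and by \<open>\<not>\<theta> \<and> \<Diamond>(\<phi> \<and> \<theta>)\<close>. Let \<open>\<theta>\<close> range over all formulas of height at most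
  that of \<open>\<phi>\<close>. What is missed are witnesses \<open>x\<close> itself, for which one new variable marks the
  reflexive points, and witnesses \<open>y \<noteq> x\<close> that agree with \<open>x\<close> up to that height. For the latter let
  \<open>f x\<close> be a proper successor of \<open>x\<close> that agrees with \<open>x\<close> up to the largest possible height below
  a given bound; it serves as a witness for all heights simultaneously. The graph of \<open>f\<close> has a proper
  3-colouring, so two more variables separate \<open>x\<close> from \<open>f x\<close>. The number of new variables
  does not depend on the formula, hence finitely many classes of formulas over the reflexive
  closures leave only finitely many classes over \<open>\<F>\<close>.\<close>

section \<open>Equivalence modulo a logic\<close>

text \<open>Curried so that \<open>equivalent \<F> \<phi>\<close> is itself the class of
  \<open>\<phi>\<close>; classes are then counted as an image.\<close>

definition equivalent :: "('w, 'm) frame set \<Rightarrow> 'm fm \<Rightarrow> 'm fm \<Rightarrow> bool" where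
  "equivalent \<F> \<phi> \<psi> \<longleftrightarrow>
     (\<forall>F\<in>\<F>. \<forall>V. (\<forall>i. V i \<subseteq> worlds F) \<longrightarrow> (\<forall>x\<in>worlds F. sat F V x \<phi> \<longleftrightarrow> sat F V x \<psi>))"

definition formulas_upto :: "'m set \<Rightarrow> nat \<Rightarrow> 'm fm set" where
  "formulas_upto A k = {\<phi> \<in> formulas A. vars \<phi> \<subseteq> {..<k}}"

lemma sat_Iff: "sat F V x (Iff \<phi> \<psi>) \<longleftrightarrow> (sat F V x \<phi> \<longleftrightarrow> sat F V x \<psi>)"
  unfolding Iff_def sat.simps by blast

lemma Iff_in_logic_iff:
  "Iff \<phi> \<psi> \<in> logic A \<F> \<longleftrightarrow> \<phi> \<in> formulas A \<and> \<psi> \<in> formulas A \<and> equivalent \<F> \<phi> \<psi>"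
proof -
  have "Iff \<phi> \<psi> \<in> formulas A \<longleftrightarrow> \<phi> \<in> formulas A \<and> \<psi> \<in> formulas A"
    by (auto simp: formulas_def Iff_def)
  then show ?thesis
    by (simp add: sat_Iff logic_def valid_def equivalent_def)
qed

lemma equivalent_class_eqI:
  assumes "equivalent \<F> \<phi> \<psi>"
  shows "equivalent \<F> \<phi> = equivalent \<F> \<psi>"
  using assms unfolding equivalent_def fun_eq_iff by simp

lemma equivalent_refl [simp]: "equivalent \<F> \<phi> \<phi>"
  by (simp add: equivalent_def)

text \<open>Pairwise inequivalent sets are those on which the class map is injective, and choosing
  one representative per class yields such a set meeting every class.\<close>

lemma locally_tabular_iff_finite_classes:
  "locally_tabular A (logic A \<F>) \<longleftrightarrow> (\<forall>k. finite (equivalent \<F> ` formulas_upto A k))"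
proof -
  have pairwise_iff: "pairwise (\<lambda>\<phi> \<psi>. Iff \<phi> \<psi> \<notin> logic A \<F>) S \<longleftrightarrow> inj_on (equivalent \<F>) S"
    if "S \<subseteq> formulas_upto A k" for S k
  proof -
    have "equivalent \<F> \<phi> = equivalent \<F> \<psi> \<longleftrightarrow> Iff \<phi> \<psi> \<in> logic A \<F>" if "\<phi> \<in> S" "\<psi> \<in> S" for \<phi> \<psi>
    proof -
      have "\<phi> \<in> formulas A" "\<psi> \<in> formulas A"
        using that \<open>S \<subseteq> _\<close> unfolding formulas_upto_def by blast+
      then show ?thesis
        unfolding Iff_in_logic_iff using equivalent_class_eqI equivalent_refl by metis
    qed
    then show ?thesis
      unfolding pairwise_def inj_on_def by blast
  qed
  have "(\<forall>S \<subseteq> formulas_upto A k. inj_on (equivalent \<F>) S \<longrightarrow> finite S)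
      \<longleftrightarrow> finite (equivalent \<F> ` formulas_upto A k)" for k
  proof
    assume *: "\<forall>S \<subseteq> formulas_upto A k. inj_on (equivalent \<F>) S \<longrightarrow> finite S"
    obtain S where "S \<subseteq> formulas_upto A k" "inj_on (equivalent \<F>) S"
      "equivalent \<F> ` formulas_upto A k = equivalent \<F> ` S"
      using subset_image_inj[of "equivalent \<F> ` formulas_upto A k" "equivalent \<F>"
          "formulas_upto A k"] by blast
    with * show "finite (equivalent \<F> ` formulas_upto A k)"
      by simp
  next
    assume *: "finite (equivalent \<F> ` formulas_upto A k)"
    show "\<forall>S \<subseteq> formulas_upto A k. inj_on (equivalent \<F>) S \<longrightarrow> finite S"
      using * by (meson finite_imageD finite_subset image_mono)
  qed
  then show ?thesis
    unfolding locally_tabular_def formulas_upto_def[symmetric] by (simp add: pairwise_iff cong: imp_cong)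
qed

text \<open>The translation may depend on the finite set \<open>T\<close>; only \<open>k'\<close>
  has to be uniform. The number of \<open>\<G>\<close>-classes in \<open>k'\<close> variables then
  bounds every finite set of pairwise \<open>\<F>\<close>-inequivalent formulas in \<open>k\<close>
  variables, and hence the number of their classes.\<close>

lemma locally_tabular_transfer:
  assumes "locally_tabular A (logic A \<G>)"
    and transl: "\<And>k. \<exists>k'. \<forall>T \<subseteq> formulas_upto A k. finite T \<longrightarrow>
      (\<exists>t. t ` T \<subseteq> formulas_upto A k' \<and>
         (\<forall>\<phi>\<in>T. \<forall>\<psi>\<in>T. equivalent \<G> (t \<phi>) (t \<psi>) \<longrightarrow> equivalent \<F> \<phi> \<psi>))"
  shows "locally_tabular A (logic A \<F>)"
  unfolding locally_tabular_iff_finite_classes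
proof
  fix k
  obtain k' where k': "\<forall>T \<subseteq> formulas_upto A k. finite T \<longrightarrow>
      (\<exists>t. t ` T \<subseteq> formulas_upto A k' \<and>
         (\<forall>\<phi>\<in>T. \<forall>\<psi>\<in>T. equivalent \<G> (t \<phi>) (t \<psi>) \<longrightarrow> equivalent \<F> \<phi> \<psi>))"
    using transl[of k] by (rule exE)
  let ?C = "equivalent \<G> ` formulas_upto A k'"
  have fin: "finite ?C"
    using assms(1) unfolding locally_tabular_iff_finite_classes by blast
  have bound: "card T \<le> card ?C"
    if T: "T \<subseteq> formulas_upto A k" "finite T" "inj_on (equivalent \<F>) T" for T
  proof -
    obtain t where t: "t ` T \<subseteq> formulas_upto A k'"
      "\<forall>\<phi>\<in>T. \<forall>\<psi>\<in>T. equivalent \<G> (t \<phi>) (t \<psi>) \<longrightarrow> equivalent \<F> \<phi> \<psi>"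
      using k' T(1,2) by (elim allE[of _ T]) auto
    have "inj_on (\<lambda>\<phi>. equivalent \<G> (t \<phi>)) T"
    proof (rule inj_onI)
      fix \<phi> \<psi> assume *: "\<phi> \<in> T" "\<psi> \<in> T" "equivalent \<G> (t \<phi>) = equivalent \<G> (t \<psi>)"
      then have "equivalent \<F> \<phi> \<psi>"
        using t(2)[rule_format, OF *(1,2)] equivalent_refl by metis
      then show "\<phi> = \<psi>"
        using inj_onD[OF T(3) equivalent_class_eqI] *(1,2) by blast
    qed
    then show ?thesis
      by (rule card_inj_on_le) (use t(1) fin in auto)
  qed
  show "finite (equivalent \<F> ` formulas_upto A k)"
  proof (rule ccontr)
    assume "infinite (equivalent \<F> ` formulas_upto A k)"
    then obtain B where B: "B \<subseteq> equivalent \<F> ` formulas_upto A k" "finite B" "card B = Suc (card ?C)"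
      using infinite_arbitrarily_large by metis
    then obtain T where T: "T \<subseteq> formulas_upto A k" "inj_on (equivalent \<F>) T" "B = equivalent \<F> ` T"
      unfolding subset_image_inj by blast
    then have "finite T" "card T = Suc (card ?C)"
      using B(2,3) card_image[of "equivalent \<F>" T] finite_imageD by auto
    with bound[of T] T(1,2) show False
      by simp
  qed
qed

section \<open>Colouring functional graphs\<close>

text \<open>Each component gets a root, on its cycle if it has one. With a cycle, \<open>b\<close>
  is the parity of the distance to the root, and \<open>c\<close> repairs the edge leaving the root.
  Without a cycle, the parity of the level relative to the root suffices.\<close>

lemma functional_graph_colouring:
  fixes f :: "'a \<Rightarrow> 'a"
  shows "\<exists>(b :: 'a \<Rightarrow> bool) (c :: 'a \<Rightarrow> bool). \<forall>x. f x \<noteq> x \<longrightarrow> b x \<noteq> b (f x) \<or> c x \<noteq> c (f x)"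
proof -
  \<comment> \<open>The weakly connected component of \<open>x\<close> in the graph of
    \<open>f\<close>.\<close>
  define comp where "comp x = {y. \<exists>i j. (f ^^ i) x = (f ^^ j) y}" for x
  define periodic where "periodic y \<longleftrightarrow> (\<exists>p>0. (f ^^ p) y = y)" for y
  define root where
    "root C = (if \<exists>y\<in>C. periodic y then SOME y. y \<in> C \<and> periodic y else SOME y. y \<in> C)" for C
  \<comment> \<open>The root is chosen from the component as a set, so \<open>x\<close> and
    \<open>f x\<close> share it.\<close>
  define r where "r x = root (comp x)" for x
  have comp_f: "comp (f x) = comp x" for x
  proof -
    have "(f ^^ i) x = (f ^^ j) y \<Longrightarrow> (f ^^ i) (f x) = (f ^^ Suc j) y" for i j y
      by (metis comp_apply funpow.simps(2) funpow_Suc_right)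
    moreover have "(f ^^ i) (f x) = (f ^^ Suc i) x" for i
      by (metis comp_apply funpow_Suc_right)
    ultimately show ?thesis
      unfolding comp_def by (intro Collect_cong) metis
  qed
  have r_f: "r (f x) = r x" for x
    by (simp add: r_def comp_f)
  have self: "x \<in> comp x" for x
    unfolding comp_def by blast
  have r_comp: "r x \<in> comp x" for x
    unfolding r_def root_def
    using self[of x] someI_ex[of "\<lambda>y. y \<in> comp x \<and> periodic y"] someI_ex[of "\<lambda>y. y \<in> comp x"]
    by (smt (verit))
  have r_periodic: "periodic (r x)" if "y \<in> comp x" "periodic y" for x y
    unfolding r_def root_def
    using that someI_ex[of "\<lambda>y. y \<in> comp x \<and> periodic y"]
    by (smt (verit))
  define b where "b x = (if periodic (r x) then even (LEAST n. (f ^^ n) x = r x)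
    else \<exists>i j. (f ^^ i) x = (f ^^ j) (r x) \<and> even (i + j))" for x
  define c where "c x \<longleftrightarrow> x = r x" for x
  have "b x \<noteq> b (f x) \<or> c x \<noteq> c (f x)" if fx: "f x \<noteq> x" for x
  proof (cases "periodic (r x)")
    case True
    then obtain p where p: "p > 0" "(f ^^ p) (r x) = r x"
      unfolding periodic_def by blast
    obtain i j where ij: "(f ^^ i) x = (f ^^ j) (r x)"
      using r_comp[of x] unfolding comp_def by blast
    \<comment> \<open>Prolonging the common path by \<open>j * p - j\<close> steps makes the root
      travel a multiple of its period, so the orbit of \<open>x\<close> reaches the root and the
      \<open>LEAST\<close> in \<open>b\<close> is attained.\<close>
    have "(f ^^ (j * p - j + i)) x = (f ^^ (j * p - j + j)) (r x)"
      by (simp only: funpow_add comp_apply ij)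
    also have "j * p - j + j = j * p"
      using p(1) by simp
    also have "(f ^^ (j * p)) (r x) = r x"
      using p(2) by (induction j) (simp_all add: funpow_add)
    finally have ex: "(f ^^ (j * p - j + i)) x = r x" .
    show ?thesis
    proof (cases "x = r x")
      case True
      then have "c x" "\<not> c (f x)"
        using fx unfolding c_def r_f by auto
      then show ?thesis by simp
    next
      case False
      then have "(LEAST n. (f ^^ n) x = r x) = Suc (LEAST n. (f ^^ Suc n) x = r x)"
        using ex by (intro Least_Suc) auto
      then have "(LEAST n. (f ^^ n) x = r x) = Suc (LEAST n. (f ^^ n) (f x) = r x)"
        by (simp add: funpow_swap1)
      then show ?thesis
        using True by (simp add: b_def r_f)
    qed
  next
    case False
    \<comment> \<open>Even representations of both \<open>x\<close> and \<open>f x\<close> would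
      bring the root to the same point after \<open>u < v\<close> steps, which puts a cycle in the
      component.\<close>
    have "\<not> (b x \<and> b (f x))"
    proof
      assume "b x \<and> b (f x)"
      then obtain i j i' j' where ij: "(f ^^ i) x = (f ^^ j) (r x)" "even (i + j)"
        "(f ^^ i') (f x) = (f ^^ j') (r x)" "even (i' + j')"
        using False unfolding b_def r_f by auto
      define u v where "u = min (Suc i' + j) (i + j')" and "v = max (Suc i' + j) (i + j')"
      have "(f ^^ (Suc i' + j)) (r x) = (f ^^ (Suc i' + i)) x"
        using ij(1) by (simp only: funpow_add comp_apply)
      also have "\<dots> = (f ^^ (i + Suc i')) x"
        by (simp add: add.commute)
      also have "\<dots> = (f ^^ (i + j')) (r x)"
        using ij(3) by (simp only: funpow_add comp_apply funpow_Suc_right)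
      finally have uv: "(f ^^ u) (r x) = (f ^^ v) (r x)"
        unfolding u_def v_def by (auto simp: min_def max_def)
      have "Suc i' + j \<noteq> i + j'"
        using ij(2,4) by presburger
      then have "u < v"
        unfolding u_def v_def by linarith
      have "(f ^^ (v - u)) ((f ^^ u) (r x)) = (f ^^ (v - u + u)) (r x)"
        by (simp only: funpow_add comp_apply)
      also have "\<dots> = (f ^^ u) (r x)"
        using uv \<open>u < v\<close> by simp
      finally have "(f ^^ (v - u)) ((f ^^ u) (r x)) = (f ^^ u) (r x)" .
      with \<open>u < v\<close> have "periodic ((f ^^ u) (r x))"
        unfolding periodic_def by (metis zero_less_diff)
      moreover have "(f ^^ u) (r x) \<in> comp x"
      proof -
        obtain i j where "(f ^^ i) x = (f ^^ j) (r x)"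
          using r_comp[of x] unfolding comp_def by blast
        then have "(f ^^ (u + i)) x = (f ^^ (u + j)) (r x)"
          by (simp only: funpow_add comp_apply)
        also have "\<dots> = (f ^^ j) ((f ^^ u) (r x))"
          by (simp add: add.commute[of u] funpow_add)
        finally show ?thesis
          unfolding comp_def by blast
      qed
      ultimately show False
        using r_periodic False by blast
    qed
    moreover have "b x \<or> b (f x)"
    proof (rule ccontr)
      assume nb: "\<not> (b x \<or> b (f x))"
      obtain i j where ij: "(f ^^ i) (f x) = (f ^^ j) (r x)"
        using r_comp[of "f x"] unfolding comp_def r_f by blast
      then have "(f ^^ Suc i) x = (f ^^ j) (r x)"
        by (simp only: funpow_Suc_right comp_apply)
      with nb ij False have "odd (i + j)" "odd (Suc i + j)"
        unfolding b_def r_f by metis+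
      then show False by simp
    qed
    ultimately show ?thesis by blast
  qed
  then show ?thesis
    by blast
qed

text \<open>A witness for the largest \<open>d \<le> D\<close> that has one serves all smaller
  \<open>d\<close> as well.\<close>

lemma antitone_choice:
  fixes Q :: "nat \<Rightarrow> 'a \<Rightarrow> 'a \<Rightarrow> bool"
  assumes "\<And>d x y. Q (Suc d) x y \<Longrightarrow> Q d x y"
  shows "\<exists>f. \<forall>x. \<forall>d\<le>D. (\<exists>y. y \<noteq> x \<and> Q d x y) \<longrightarrow> f x \<noteq> x \<and> Q d x (f x)"
proof -
  have anti: "Q d x y" if "Q e x y" "d \<le> e" for d e x y
    using that(2,1) by (induction rule: dec_induct) (auto intro: assms)
  have "\<exists>z. \<forall>d\<le>D. (\<exists>y. y \<noteq> x \<and> Q d x y) \<longrightarrow> z \<noteq> x \<and> Q d x z" for x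
  proof (induction D)
    case (Suc D)
    show ?case
    proof (cases "\<exists>y. y \<noteq> x \<and> Q (Suc D) x y")
      case True
      then show ?thesis using anti by blast
    next
      case False
      then show ?thesis using Suc by (simp add: le_Suc_eq) blast
    qed
  qed auto
  then show ?thesis by - (intro choice allI)
qed

lemma antitone_colouring:
  fixes Q :: "nat \<Rightarrow> 'a \<Rightarrow> 'a \<Rightarrow> bool"
  assumes "\<And>d x y. Q (Suc d) x y \<Longrightarrow> Q d x y"
  shows "\<exists>(b :: 'a \<Rightarrow> bool) (c :: 'a \<Rightarrow> bool). \<forall>x. \<forall>d\<le>D. (\<exists>y. y \<noteq> x \<and> Q d x y) \<longrightarrow>
    (\<exists>y. Q d x y \<and> (b x \<noteq> b y \<or> c x \<noteq> c y))"
proof -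
  obtain f where f: "\<And>x d. d \<le> D \<Longrightarrow> \<exists>y. y \<noteq> x \<and> Q d x y \<Longrightarrow> f x \<noteq> x \<and> Q d x (f x)"
    using antitone_choice[of Q D] assms by metis
  obtain b c :: "'a \<Rightarrow> bool" where bc: "\<forall>x. f x \<noteq> x \<longrightarrow> b x \<noteq> b (f x) \<or> c x \<noteq> c (f x)"
    using functional_graph_colouring[of f] by (elim exE)
  show ?thesis
  proof (rule exI[of _ b], rule exI[of _ c], intro allI impI)
    fix x d assume "d \<le> D" "\<exists>y. y \<noteq> x \<and> Q d x y"
    then show "\<exists>y. Q d x y \<and> (b x \<noteq> b y \<or> c x \<noteq> c y)"
      using f[of d x] bc by blast
  qed
qed

section \<open>From frames to reflexive closures\<close>

definition Conj :: "'m fm \<Rightarrow> 'm fm \<Rightarrow> 'm fm" where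
  "Conj \<phi> \<psi> = Imp (Imp \<phi> (Imp \<psi> Bot)) Bot"

definition Disj :: "'m fm \<Rightarrow> 'm fm \<Rightarrow> 'm fm" where
  "Disj \<phi> \<psi> = Imp (Imp \<phi> Bot) \<psi>"

definition Disjs :: "'m fm list \<Rightarrow> 'm fm" where
  "Disjs \<phi>s = foldr Disj \<phi>s Bot"

lemma sat_Conj [simp]: "sat F V x (Conj \<phi> \<psi>) \<longleftrightarrow> sat F V x \<phi> \<and> sat F V x \<psi>"
  and sat_Disj [simp]: "sat F V x (Disj \<phi> \<psi>) \<longleftrightarrow> sat F V x \<phi> \<or> sat F V x \<psi>"
  by (auto simp: Conj_def Disj_def)

lemma sat_Disjs [simp]: "sat F V x (Disjs \<phi>s) \<longleftrightarrow> (\<exists>\<phi>\<in>set \<phi>s. sat F V x \<phi>)"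
  unfolding Disjs_def by (induction \<phi>s) auto

lemma formulas_upto_simps [simp]:
  "Var i \<in> formulas_upto A k \<longleftrightarrow> i < k"
  "Bot \<in> formulas_upto A k"
  "Imp \<phi> \<psi> \<in> formulas_upto A k \<longleftrightarrow> \<phi> \<in> formulas_upto A k \<and> \<psi> \<in> formulas_upto A k"
  "Dia m \<phi> \<in> formulas_upto A k \<longleftrightarrow> m \<in> A \<and> \<phi> \<in> formulas_upto A k"
  "Conj \<phi> \<psi> \<in> formulas_upto A k \<longleftrightarrow> \<phi> \<in> formulas_upto A k \<and> \<psi> \<in> formulas_upto A k"
  "Disj \<phi> \<psi> \<in> formulas_upto A k \<longleftrightarrow> \<phi> \<in> formulas_upto A k \<and> \<psi> \<in> formulas_upto A k"
  by (auto simp: formulas_upto_def formulas_def Conj_def Disj_def)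

lemma Disjs_formulas_upto [simp]:
  "Disjs \<phi>s \<in> formulas_upto A k \<longleftrightarrow> set \<phi>s \<subseteq> formulas_upto A k"
  unfolding Disjs_def by (induction \<phi>s) auto

lemma worlds_refl_frame [simp]: "worlds (refl_frame F) = worlds F"
  and rel_refl_frame [simp]: "rel (refl_frame F) m = rel F m \<union> Id_on (worlds F)"
  by (simp_all add: refl_frame_def)

primrec reflexive_transl :: "'m fm \<Rightarrow> 'm fm" where
  "reflexive_transl (Var i) = Var i"
| "reflexive_transl Bot = Bot"
| "reflexive_transl (Imp \<phi> \<psi>) = Imp (reflexive_transl \<phi>) (reflexive_transl \<psi>)"
| "reflexive_transl (Dia m \<phi>) = Disj (reflexive_transl \<phi>) (Dia m (reflexive_transl \<phi>))"

lemma reflexive_transl_formulas_upto: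
  "\<phi> \<in> formulas_upto A k \<Longrightarrow> reflexive_transl \<phi> \<in> formulas_upto A k"
  by (induction \<phi>) simp_all

lemma sat_reflexive_transl:
  "x \<in> worlds F \<Longrightarrow> sat F V x (reflexive_transl \<phi>) \<longleftrightarrow> sat (refl_frame F) V x \<phi>"
  by (induction \<phi> arbitrary: x) auto

lemma equivalent_reflexive_transl:
  assumes "equivalent \<F> (reflexive_transl \<phi>) (reflexive_transl \<psi>)"
  shows "equivalent (refl_frame ` \<F>) \<phi> \<psi>"
  using assms by (simp add: equivalent_def sat_reflexive_transl)

lemma locally_tabular_refl_frames:
  assumes "locally_tabular A (logic A \<F>)"
  shows "locally_tabular A (logic A (refl_frame ` \<F>))"
\<comment> \<open>The translation adds no variables, so \<open>k' = k\<close>.\<close>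
proof (rule locally_tabular_transfer[OF assms], rule exI, intro allI impI exI conjI ballI)
  fix k T assume "T \<subseteq> formulas_upto A k"
  then show "reflexive_transl ` T \<subseteq> formulas_upto A k"
    using reflexive_transl_formulas_upto by blast
qed (rule equivalent_reflexive_transl)

section \<open>From reflexive closures to frames\<close>

text \<open>Level \<open>d\<close> holds the formulas of height less than \<open>d\<close>, atoms
  having height 0. Lists allow a disjunction to range over a whole level.\<close>

primrec fm_list :: "'m list \<Rightarrow> nat \<Rightarrow> nat \<Rightarrow> 'm fm list" where
  "fm_list ms k 0 = []"
| "fm_list ms k (Suc d) = map Var [0..<k] @ Bot #
     concat (map (\<lambda>\<phi>. map (Imp \<phi>) (fm_list ms k d)) (fm_list ms k d)) @
     concat (map (\<lambda>m. map (Dia m) (fm_list ms k d)) ms)"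

lemma in_fm_list_Suc_iff:
  "\<phi> \<in> set (fm_list ms k (Suc d)) \<longleftrightarrow> (\<exists>i<k. \<phi> = Var i) \<or> \<phi> = Bot \<or>
     (\<exists>\<psi>\<in>set (fm_list ms k d). \<exists>\<chi>\<in>set (fm_list ms k d). \<phi> = Imp \<psi> \<chi>) \<or>
     (\<exists>m\<in>set ms. \<exists>\<psi>\<in>set (fm_list ms k d). \<phi> = Dia m \<psi>)"
  by (auto simp: image_iff)

declare fm_list.simps(2) [simp del]

lemma fm_list_Suc_mono: "set (fm_list ms k d) \<subseteq> set (fm_list ms k (Suc d))"
proof (induction d)
  case (Suc d)
  show ?case
  proof
    fix \<phi> assume "\<phi> \<in> set (fm_list ms k (Suc d))"
    then show "\<phi> \<in> set (fm_list ms k (Suc (Suc d)))"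
      using Suc in_fm_list_Suc_iff[of \<phi> ms k d] in_fm_list_Suc_iff[of \<phi> ms k "Suc d"] by blast
  qed
qed simp

lemma fm_list_mono: "d \<le> e \<Longrightarrow> set (fm_list ms k d) \<subseteq> set (fm_list ms k e)"
  by (rule lift_Suc_mono_le[of "\<lambda>d. set (fm_list ms k d)"]) (rule fm_list_Suc_mono)

lemma fm_list_exhaustive:
  "\<phi> \<in> formulas_upto (set ms) k \<Longrightarrow> \<exists>d. \<phi> \<in> set (fm_list ms k d)"
proof (induction \<phi>)
  case (Var i)
  then have "Var i \<in> set (fm_list ms k (Suc 0))" by (simp add: in_fm_list_Suc_iff)
  then show ?case by blast
next
  case Bot
  have "Bot \<in> set (fm_list ms k (Suc 0))" by (simp add: in_fm_list_Suc_iff)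
  then show ?case by blast
next
  case (Imp \<phi> \<psi>)
  then obtain d e where "\<phi> \<in> set (fm_list ms k d)" "\<psi> \<in> set (fm_list ms k e)" by auto
  then have "\<phi> \<in> set (fm_list ms k (max d e))" "\<psi> \<in> set (fm_list ms k (max d e))"
    using fm_list_mono[of d "max d e" ms k] fm_list_mono[of e "max d e" ms k] by auto
  then have "Imp \<phi> \<psi> \<in> set (fm_list ms k (Suc (max d e)))" by (simp add: in_fm_list_Suc_iff)
  then show ?case by blast
next
  case (Dia m \<phi>)
  then obtain d where "\<phi> \<in> set (fm_list ms k d)" by auto
  with Dia have "Dia m \<phi> \<in> set (fm_list ms k (Suc d))" by (simp add: in_fm_list_Suc_iff)
  then show ?case by blast
qed

lemma finite_subset_fm_list:
  assumes "finite T" "T \<subseteq> formulas_upto (set ms) k"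
  shows "\<exists>d. T \<subseteq> set (fm_list ms k d)"
  using assms
proof (induction T rule: finite_induct)
  case (insert \<phi> T)
  then obtain d e where "T \<subseteq> set (fm_list ms k d)" "\<phi> \<in> set (fm_list ms k e)"
    using fm_list_exhaustive[of \<phi> ms k] by auto
  then have "insert \<phi> T \<subseteq> set (fm_list ms k (max d e))"
    using fm_list_mono[of d "max d e" ms k] fm_list_mono[of e "max d e" ms k] by auto
  then show ?case by blast
qed simp

section \<open>Translation into the reflexive closure\<close>

definition separating_dia :: "'m \<Rightarrow> 'm fm \<Rightarrow> 'm fm \<Rightarrow> 'm fm" where
  "separating_dia m \<phi> \<theta> = Disj (Conj \<theta> (Dia m (Conj \<phi> (Imp \<theta> Bot)))) (Conj (Imp \<theta> Bot) (Dia m (Conj \<phi> \<theta>)))"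

text \<open>For \<open>m\<close> with \<open>idx m = q\<close>, the variable \<open>k + 3 * q\<close> marks the \<open>m\<close>-reflexive points, and
  \<open>k + 3 * q + 1\<close>, \<open>k + 3 * q + 2\<close> are the bits of the colouring for \<open>m\<close>.
  \<open>transl ms k idx d\<close> is meaningful only on formulas in \<open>fm_list ms k d\<close>.\<close>

primrec transl :: "'m list \<Rightarrow> nat \<Rightarrow> ('m \<Rightarrow> nat) \<Rightarrow> nat \<Rightarrow> 'm fm \<Rightarrow> 'm fm" where
  "transl ms k idx 0 = (\<lambda>\<phi>. \<phi>)"
| "transl ms k idx (Suc d) = (\<lambda>\<phi>. case \<phi> of
      Var i \<Rightarrow> Var i
    | Bot \<Rightarrow> Bot
    | Imp \<phi> \<psi> \<Rightarrow> Imp (transl ms k idx d \<phi>) (transl ms k idx d \<psi>)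
    | Dia m \<phi> \<Rightarrow> Disj (Conj (transl ms k idx d \<phi>) (Var (k + 3 * idx m)))
        (Disjs (map (separating_dia m (transl ms k idx d \<phi>))
          (Var (k + 3 * idx m + 1) # Var (k + 3 * idx m + 2) #
           map (transl ms k idx d) (fm_list ms k d)))))"

text \<open>The bound does not involve \<open>d\<close>, which supplies the uniform
  \<open>k'\<close> for \<open>locally_tabular_transfer\<close>.\<close>

lemma transl_formulas_upto:
  assumes "\<And>m. m \<in> set ms \<Longrightarrow> idx m < n" "\<phi> \<in> set (fm_list ms k d)"
  shows "transl ms k idx d \<phi> \<in> formulas_upto (set ms) (k + 3 * n)"
  using assms(2)
proof (induction d arbitrary: \<phi>)
  case (Suc d)
  have "k + 3 * idx m + 2 < k + 3 * n" if "m \<in> set ms" for m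
    using assms(1)[OF that] by linarith
  with Suc show ?case
    by (fastforce simp: separating_dia_def in_fm_list_Suc_iff)
qed simp

text \<open>A witness disagrees with \<open>x\<close> on \<open>\<theta>\<close>, so it is not
  \<open>x\<close> and the edge to it is not an added loop.\<close>

lemma sat_separating_dia:
  assumes "x \<in> worlds F"
  shows "sat (refl_frame F) V x (separating_dia m \<phi> \<theta>) \<longleftrightarrow>
    (\<exists>y\<in>worlds F. (x, y) \<in> rel F m \<and> sat (refl_frame F) V y \<phi> \<and>
       sat (refl_frame F) V x \<theta> \<noteq> sat (refl_frame F) V y \<theta>)"
  using assms unfolding separating_dia_def by auto

text \<open>Induction on the level rather than on \<open>\<phi>\<close>, because the translation of
  a diamond involves all formulas of the level below and not just subformulas.\<close>

lemma sat_transl: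
  assumes V: "\<And>i. i < k \<Longrightarrow> V' i = V i"
    and refl: "\<And>m x. m \<in> set ms \<Longrightarrow> x \<in> worlds F \<Longrightarrow> x \<in> V' (k + 3 * idx m) \<longleftrightarrow> (x, x) \<in> rel F m"
    and colours: "\<And>m x y d. m \<in> set ms \<Longrightarrow> x \<in> worlds F \<Longrightarrow> d \<le> D \<Longrightarrow>
      y \<in> worlds F \<Longrightarrow> y \<noteq> x \<Longrightarrow> (x, y) \<in> rel F m \<Longrightarrow>
      \<forall>\<theta>\<in>set (fm_list ms k d). sat F V x \<theta> = sat F V y \<theta> \<Longrightarrow>
      \<exists>z\<in>worlds F. (x, z) \<in> rel F m \<and>
        (\<forall>\<theta>\<in>set (fm_list ms k d). sat F V x \<theta> = sat F V z \<theta>) \<and>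
        ((x \<in> V' (k + 3 * idx m + 1)) \<noteq> (z \<in> V' (k + 3 * idx m + 1)) \<or>
         (x \<in> V' (k + 3 * idx m + 2)) \<noteq> (z \<in> V' (k + 3 * idx m + 2)))"
    and "d \<le> D" "\<phi> \<in> set (fm_list ms k d)" "x \<in> worlds F"
  shows "sat (refl_frame F) V' x (transl ms k idx d \<phi>) \<longleftrightarrow> sat F V x \<phi>"
  using assms(4-)
proof (induction d arbitrary: \<phi> x)
  case (Suc d)
  let ?t = "transl ms k idx d" and ?L = "set (fm_list ms k d)"
  have IH: "sat (refl_frame F) V' y (?t \<theta>) \<longleftrightarrow> sat F V y \<theta>" if "\<theta> \<in> ?L" "y \<in> worlds F" for \<theta> y
    using Suc.IH[of \<theta> y] Suc.prems(1) that by simp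
  consider i where "\<phi> = Var i" "i < k" | "\<phi> = Bot"
    | \<psi> \<chi> where "\<phi> = Imp \<psi> \<chi>" "\<psi> \<in> ?L" "\<chi> \<in> ?L"
    | m \<psi> where "\<phi> = Dia m \<psi>" "m \<in> set ms" "\<psi> \<in> ?L"
    using Suc.prems(2) unfolding in_fm_list_Suc_iff by blast
  then show ?case
  proof cases
    case (4 m \<psi>)
    let ?p = "\<lambda>j. V' (k + 3 * idx m + j)"
    have "sat (refl_frame F) V' x (transl ms k idx (Suc d) \<phi>) \<longleftrightarrow>
        sat F V x \<psi> \<and> (x, x) \<in> rel F m \<or>
        (\<exists>y\<in>worlds F. (x, y) \<in> rel F m \<and> sat F V y \<psi> \<and>
          ((x \<in> ?p 1) \<noteq> (y \<in> ?p 1) \<or> (x \<in> ?p 2) \<noteq> (y \<in> ?p 2) \<or>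
           (\<exists>\<theta>\<in>?L. sat F V x \<theta> \<noteq> sat F V y \<theta>)))"
      using 4 Suc.prems(3) IH refl by (auto simp: sat_separating_dia)
    also have "\<dots> \<longleftrightarrow> sat F V x (Dia m \<psi>)"
    proof
      assume "sat F V x (Dia m \<psi>)"
      then obtain y where y: "y \<in> worlds F" "(x, y) \<in> rel F m" "sat F V y \<psi>"
        by auto
      show "sat F V x \<psi> \<and> (x, x) \<in> rel F m \<or>
        (\<exists>y\<in>worlds F. (x, y) \<in> rel F m \<and> sat F V y \<psi> \<and>
          ((x \<in> ?p 1) \<noteq> (y \<in> ?p 1) \<or> (x \<in> ?p 2) \<noteq> (y \<in> ?p 2) \<or>
           (\<exists>\<theta>\<in>?L. sat F V x \<theta> \<noteq> sat F V y \<theta>)))"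
      proof (cases "y = x \<or> (\<exists>\<theta>\<in>?L. sat F V x \<theta> \<noteq> sat F V y \<theta>)")
        case True
        then show ?thesis using y by auto
      next
        case False
        then obtain z where "z \<in> worlds F" "(x, z) \<in> rel F m"
          "\<forall>\<theta>\<in>?L. sat F V x \<theta> = sat F V z \<theta>"
          "(x \<in> ?p 1) \<noteq> (z \<in> ?p 1) \<or> (x \<in> ?p 2) \<noteq> (z \<in> ?p 2)"
          using colours[of m x d y] 4(2) Suc.prems(1,3) y by (auto simp: Suc_le_lessD less_imp_le)
        \<comment> \<open>Both \<open>y\<close> and \<open>z\<close> agree with \<open>x\<close> on
          the level containing \<open>\<psi>\<close>, so \<open>z\<close> can replace
          \<open>y\<close> as a witness.\<close>
        moreover from this have "sat F V z \<psi>"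
          using False y(3) 4(3) by metis
        ultimately show ?thesis by blast
      qed
    qed (use Suc.prems(3) in auto)
    finally show ?thesis
      using 4(1) by simp
  qed (simp_all add: V IH Suc.prems(3))
qed simp

lemma equivalent_transl:
  assumes inj: "inj_on idx (set ms)"
    and \<phi>: "\<phi> \<in> set (fm_list ms k D)" and \<psi>: "\<psi> \<in> set (fm_list ms k D)"
    and equiv: "equivalent (refl_frame ` \<F>) (transl ms k idx D \<phi>) (transl ms k idx D \<psi>)"
  shows "equivalent \<F> \<phi> \<psi>"
  unfolding equivalent_def
proof (intro ballI allI impI)
  fix F and V :: "nat \<Rightarrow> _" and x
  assume F: "F \<in> \<F>" and V: "\<forall>i. V i \<subseteq> worlds F" and x: "x \<in> worlds F"
  \<comment> \<open>Successors that the formulas of level \<open>d\<close> cannot tell from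
    \<open>x\<close>; antitone in \<open>d\<close> since the levels grow.\<close>
  define Q where "Q m d x y \<longleftrightarrow> x \<in> worlds F \<and> y \<in> worlds F \<and> (x, y) \<in> rel F m \<and>
    (\<forall>\<theta>\<in>set (fm_list ms k d). sat F V x \<theta> = sat F V y \<theta>)" for m d x y
  have Q_anti: "Q m d x y" if "Q m (Suc d) x y" for m d x y
    using that fm_list_Suc_mono[of ms k d] unfolding Q_def by blast
  have "\<exists>(b :: _ \<Rightarrow> bool) (c :: _ \<Rightarrow> bool). \<forall>x. \<forall>d\<le>D. (\<exists>y. y \<noteq> x \<and> Q m d x y) \<longrightarrow>
      (\<exists>y. Q m d x y \<and> (b x \<noteq> b y \<or> c x \<noteq> c y))" for m
    by (rule antitone_colouring) (rule Q_anti)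
  then obtain b c :: "_ \<Rightarrow> _ \<Rightarrow> bool" where "\<forall>m. \<forall>x. \<forall>d\<le>D. (\<exists>y. y \<noteq> x \<and> Q m d x y) \<longrightarrow>
      (\<exists>y. Q m d x y \<and> (b m x \<noteq> b m y \<or> c m x \<noteq> c m y))"
    by metis
  then have bc: "\<exists>y. Q m d x y \<and> (b m x \<noteq> b m y \<or> c m x \<noteq> c m y)"
    if "d \<le> D" "\<exists>y. y \<noteq> x \<and> Q m d x y" for m x d
    using that by blast
  define P where "P m j = {x \<in> worlds F.
    if j = 0 then (x, x) \<in> rel F m else if j = 1 then b m x else c m x}" for m and j :: nat
  \<comment> \<open>Quotient and remainder by 3 decode a new variable into a modality and one of its
    three markers. Indices that code no modality of \<open>ms\<close> get a junk one, still with a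
    set of worlds as value.\<close>
  define V' where "V' i = (if i < k then V i
    else P (inv_into (set ms) idx ((i - k) div 3)) ((i - k) mod 3))" for i
  have V'_new: "V' (k + 3 * idx m + j) = P m j" if "m \<in> set ms" "j < 3" for m j
    using that inj by (simp add: V'_def)
  have sat: "sat (refl_frame F) V' x (transl ms k idx D \<theta>) \<longleftrightarrow> sat F V x \<theta>"
    if "\<theta> \<in> set (fm_list ms k D)" for \<theta>
  proof (rule sat_transl[OF _ _ _ order_refl that x])
    fix m x y d
    assume *: "m \<in> set ms" "x \<in> worlds F" "d \<le> D" "y \<in> worlds F" "y \<noteq> x" "(x, y) \<in> rel F m"
      "\<forall>\<theta>\<in>set (fm_list ms k d). sat F V x \<theta> = sat F V y \<theta>"
    then obtain z where "Q m d x z" "b m x \<noteq> b m z \<or> c m x \<noteq> c m z"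
      using bc[of d x m] unfolding Q_def by blast
    then show "\<exists>z\<in>worlds F. (x, z) \<in> rel F m \<and>
        (\<forall>\<theta>\<in>set (fm_list ms k d). sat F V x \<theta> = sat F V z \<theta>) \<and>
        ((x \<in> V' (k + 3 * idx m + 1)) \<noteq> (z \<in> V' (k + 3 * idx m + 1)) \<or>
         (x \<in> V' (k + 3 * idx m + 2)) \<noteq> (z \<in> V' (k + 3 * idx m + 2)))"
      using V'_new[OF *(1), of 1] V'_new[OF *(1), of 2] unfolding Q_def P_def
      by (intro bexI[of _ z]) simp_all
  next
    show "x \<in> V' (k + 3 * idx m) \<longleftrightarrow> (x, x) \<in> rel F m" if "m \<in> set ms" "x \<in> worlds F" for m x
      using V'_new[of m 0] that by (simp add: P_def)
  qed (simp add: V'_def)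
  have "\<forall>i. V' i \<subseteq> worlds (refl_frame F)"
    using V by (auto simp: V'_def P_def)
  then have "sat (refl_frame F) V' x (transl ms k idx D \<phi>) \<longleftrightarrow>
      sat (refl_frame F) V' x (transl ms k idx D \<psi>)"
    using equiv F x unfolding equivalent_def by auto
  then show "sat F V x \<phi> \<longleftrightarrow> sat F V x \<psi>"
    using sat \<phi> \<psi> by simp
qed

lemma locally_tabular_of_refl_frames:
  assumes "finite A" "locally_tabular A (logic A (refl_frame ` \<F>))"
  shows "locally_tabular A (logic A \<F>)"
proof (rule locally_tabular_transfer[OF assms(2)], rule exI, intro allI impI)
  fix k T assume T: "T \<subseteq> formulas_upto A k" "finite T"
  obtain ms where ms: "set ms = A"
    using finite_list[OF assms(1)] by blast
  obtain idx where idx: "bij_betw idx A {0..<card A}"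
    using ex_bij_betw_finite_nat[OF assms(1)] by blast
  \<comment> \<open>\<open>D\<close> depends on \<open>T\<close>, as the translation may; the
    variable bound \<open>k + 3 * card A\<close> does not.\<close>
  obtain D where D: "T \<subseteq> set (fm_list ms k D)"
    using finite_subset_fm_list[of T ms k] T ms by blast
  have "transl ms k idx D ` T \<subseteq> formulas_upto A (k + 3 * card A)"
    using transl_formulas_upto[of ms idx "card A"] D bij_betwE[OF idx] ms by fastforce
  moreover have "\<forall>\<phi>\<in>T. \<forall>\<psi>\<in>T. equivalent (refl_frame ` \<F>) (transl ms k idx D \<phi>)
      (transl ms k idx D \<psi>) \<longrightarrow> equivalent \<F> \<phi> \<psi>"
    using equivalent_transl[of idx ms] bij_betw_imp_inj_on[OF idx] D ms by blast
  ultimately show "\<exists>t. t ` T \<subseteq> formulas_upto A (k + 3 * card A) \<and>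
      (\<forall>\<phi>\<in>T. \<forall>\<psi>\<in>T. equivalent (refl_frame ` \<F>) (t \<phi>) (t \<psi>) \<longrightarrow> equivalent \<F> \<phi> \<psi>)"
    by blast
qed

theorem theorem4p3:
  fixes A :: "'m set" and \<F> :: "('w, 'm) frame set"
  assumes "finite A"
    and "\<And>F. F \<in> \<F> \<Longrightarrow> is_frame A F"
  shows "locally_tabular A (logic A \<F>) \<longleftrightarrow> locally_tabular A (logic A (refl_frame ` \<F>))"
  using locally_tabular_refl_frames locally_tabular_of_refl_frames[OF assms(1)] by blast

end
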